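(* Let $d \ge 2$ and let $E \subseteq \mathbb{R}^d$ be a $1$-rectifiable set with $\mathcal{H}^1(E) > 0$. Then the set $\mathcal{B} = \{p \in \mathbb{R}^d : \mathcal{H}^1(\Delta_p(E)) = 0\}$ of bad pins for $E$ is contained in an affine subspace of $\mathbb{R}^d$ of dimension at most $d-2$.
   Context: $\mathcal{H}^1$ denotes $1$-dimensional Hausdorff measure. A Borel set $E \subseteq \mathbb{R}^d$ is $1$-rectifiable if there are Lipschitz maps $f_j : \mathbb{R} \to \mathbb{R}^d$, $j \ge 1$, with $\mathcal{H}^1\big(E \setminus \bigcup_{j=1}^\infty f_j(\mathbb{R})\big) = 0$. For $p \in \mathbb{R}^d$, the pinned distance set of $E$ at $p$ is $\Delta_p(E) = \{|z - p| : z \in E\} \subseteq \mathbb{R}$. A point $p \in \mathbb{R}^d$ is a good pin for $E$ if $\mathcal{H}^1(\Delta_p(E)) > 0$, and a bad pin otherwise. *)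

theory Defs
  imports "HOL-Analysis.Analysis"
begin

text \<open>
  One-dimensional Hausdorff measure, as an outer measure on all subsets of a metric space.
  Countable covers are indexed by \<open>nat\<close>; finite covers are included since \<open>U i = {}\<close> is allowed.
  The explicit \<open>bounded\<close> is needed because \<open>diameter\<close> is real-valued and only meaningful
  for bounded sets.  In dimension 1 the usual normalisation constant is 1.
\<close>

definition hausdorff1_size :: "real \<Rightarrow> 'a::metric_space set \<Rightarrow> ennreal" where
  "hausdorff1_size \<delta> A =
    (INF U \<in> {U :: nat \<Rightarrow> 'a set. A \<subseteq> (\<Union>i. U i) \<and> (\<forall>i. bounded (U i) \<and> diameter (U i) \<le> \<delta>)}.
       \<Sum>i. ennreal (diameter (U i)))"

definition hausdorff1 :: "'a::metric_space set \<Rightarrow> ennreal" where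
  "hausdorff1 A = (SUP \<delta>\<in>{0<..}. hausdorff1_size \<delta> A)"

definition rectifiable1 :: "'a::euclidean_space set \<Rightarrow> bool" where
  "rectifiable1 E \<longleftrightarrow> E \<in> sets borel \<and>
    (\<exists>f :: nat \<Rightarrow> real \<Rightarrow> 'a.
       (\<forall>j. \<exists>L. L-lipschitz_on UNIV (f j)) \<and>
       hausdorff1 (E - (\<Union>j. range (f j))) = 0)"

definition pinned_distances :: "'a::real_normed_vector \<Rightarrow> 'a set \<Rightarrow> real set" where
  "pinned_distances p E = {norm (z - p) | z. z \<in> E}"

definition bad_pins :: "'a::real_normed_vector set \<Rightarrow> 'a set" where
  "bad_pins E = {p. hausdorff1 (pinned_distances p E) = 0}"

end

theory Submission
  imports Defs
begin

text \<open>
  Suppose that the bad pins do not lie in an affine subspace of codimension two.  Then finitely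
  many of them, \<open>P\<close>, span at least a hyperplane, and it has to be shown that
  \<open>E\<close> is null.  As \<open>E\<close> is covered by countably many Lipschitz curves up to
  a null set, it is enough to treat \<open>E \<inter> range f\<close> for one Lipschitz \<open>f\<close>.

  The distances to the points of \<open>P\<close> are almost coordinates.  Differences of their
  squares determine the projection of a point to the hyperplane, and one squared distance then
  determines the square of the height above it.  So on bounded pieces inside the hyperplane, or on
  one side of it and away from it, the distance between two points is controlled by the
  differences of their distances to the pins
  (\<^term>\<open>norm (z - w) \<le> C * (\<Sum>p\<in>P. \<bar>norm (z - p) - norm (w - p)\<bar>)\<close>, lemma
  \<open>norm_diff_le_sum_distance_diffs\<close>).  Countably many such pieces exhaust the space.

  Let \<open>K\<close> be a bounded part of the preimage of \<open>E\<close> under \<open>f\<close>.  Each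
  function \<open>u t = norm (f t - p)\<close> is Lipschitz and maps \<open>K\<close> to a null set,
  because \<open>p\<close> is a bad pin, so \<open>u\<close> should not move along
  \<open>K\<close>.  The precise form is \<open>lipschitz_increment_le\<close>: on an interval \<open>I\<close> the function \<open>u\<close>
  oscillates by at most the Lipschitz constant times the measure of \<open>I - K\<close>, since
  \<open>u ` I\<close> is an interval and its part \<open>u ` K\<close> has measure zero.  Covering
  \<open>K\<close> by intervals with small total excess over \<open>K\<close> therefore covers each of
  the pieces of \<open>f ` K\<close> by sets with small total diameter
  (\<open>hausdorff1_null_on_lipschitz_curve\<close>).
\<close>

section \<open>Null sets of one-dimensional Hausdorff measure\<close>

text \<open>
  For null sets the mesh \<open>\<delta>\<close> does not matter: in a cover whose diameters sum to at most
  \<open>min \<delta> \<epsilon>\<close>, every single diameter is at most \<open>\<delta>\<close>.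
\<close>

lemma hausdorff1_null_iff:
  fixes A :: "'a::metric_space set"
  shows "hausdorff1 A = 0 \<longleftrightarrow>
    (\<forall>\<epsilon>>0. \<exists>U::nat \<Rightarrow> 'a set. A \<subseteq> (\<Union>i. U i) \<and> (\<forall>i. bounded (U i)) \<and>
       (\<Sum>i. ennreal (diameter (U i))) \<le> ennreal \<epsilon>)" (is "_ \<longleftrightarrow> (\<forall>\<epsilon>>0. ?P \<epsilon>)")
proof
  assume "hausdorff1 A = 0"
  have "hausdorff1_size 1 A \<le> hausdorff1 A"
    unfolding hausdorff1_def by (rule SUP_upper) simp
  then have 0: "hausdorff1_size 1 A = 0"
    using \<open>hausdorff1 A = 0\<close> by simp
  show "\<forall>\<epsilon>>0. ?P \<epsilon>"
  proof (intro allI impI)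
    fix \<epsilon> :: real assume "\<epsilon> > 0"
    then have "hausdorff1_size 1 A < ennreal \<epsilon>"
      using 0 by simp
    then show "?P \<epsilon>"
      unfolding hausdorff1_size_def INF_less_iff by (auto intro: less_imp_le)
  qed
next
  assume *: "\<forall>\<epsilon>>0. ?P \<epsilon>"
  have "hausdorff1_size \<delta> A = 0" if "\<delta> > 0" for \<delta>
  proof -
    have "hausdorff1_size \<delta> A \<le> 0 + ennreal \<epsilon>" if "\<epsilon> > 0" for \<epsilon>
    proof -
      have "min \<delta> \<epsilon> > 0"
        using \<open>\<delta> > 0\<close> \<open>\<epsilon> > 0\<close> by simp
      then obtain U :: "nat \<Rightarrow> 'a set" where U: "A \<subseteq> (\<Union>i. U i)" "\<And>i. bounded (U i)"
        and s: "(\<Sum>i. ennreal (diameter (U i))) \<le> ennreal (min \<delta> \<epsilon>)"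
        using * by meson
      have "ennreal (diameter (U i)) \<le> (\<Sum>i. ennreal (diameter (U i)))" for i
        using sum_le_suminf[of "\<lambda>i. ennreal (diameter (U i))" "{i}"] by simp
      then have "ennreal (diameter (U i)) \<le> ennreal (min \<delta> \<epsilon>)" for i
        using s order_trans by blast
      then have "diameter (U i) \<le> \<delta>" for i
        using \<open>min \<delta> \<epsilon> > 0\<close> ennreal_le_iff[of "min \<delta> \<epsilon>" "diameter (U i)"] by simp
      then have "hausdorff1_size \<delta> A \<le> (\<Sum>i. ennreal (diameter (U i)))"
        unfolding hausdorff1_size_def using U by (intro INF_lower) auto
      also have "\<dots> \<le> ennreal \<epsilon>"
        using s by (rule order_trans) (simp add: ennreal_leI)
      finally show ?thesis by simp
    qed
    then have "hausdorff1_size \<delta> A \<le> 0"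
      by (rule ennreal_le_epsilon)
    then show ?thesis by simp
  qed
  then show "hausdorff1 A = 0"
    unfolding hausdorff1_def by (intro antisym SUP_least) (auto)
qed

lemma hausdorff1_null_subset:
  fixes A B :: "'a::metric_space set"
  assumes "hausdorff1 B = 0" "A \<subseteq> B"
  shows "hausdorff1 A = 0"
  unfolding hausdorff1_null_iff
proof (intro allI impI)
  fix \<epsilon> :: real assume "\<epsilon> > 0"
  then obtain U :: "nat \<Rightarrow> 'a set" where "B \<subseteq> (\<Union>i. U i)" "\<forall>i. bounded (U i)"
    "(\<Sum>i. ennreal (diameter (U i))) \<le> ennreal \<epsilon>"
    using assms(1) unfolding hausdorff1_null_iff by meson
  then show "\<exists>U::nat \<Rightarrow> 'a set. A \<subseteq> (\<Union>i. U i) \<and> (\<forall>i. bounded (U i)) \<and>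
       (\<Sum>i. ennreal (diameter (U i))) \<le> ennreal \<epsilon>"
    using assms(2) by (intro exI[of _ U] conjI) (rule order_trans)
qed

lemma hausdorff1_null_UN_nat:
  fixes A :: "nat \<Rightarrow> 'a::metric_space set"
  assumes "\<And>n. hausdorff1 (A n) = 0"
  shows "hausdorff1 (\<Union>n. A n) = 0"
  unfolding hausdorff1_null_iff
proof (intro allI impI)
  fix \<epsilon> :: real assume "\<epsilon> > 0"
  have "\<exists>U::nat \<Rightarrow> 'a set. A n \<subseteq> (\<Union>i. U i) \<and> (\<forall>i. bounded (U i)) \<and>
       (\<Sum>i. ennreal (diameter (U i))) \<le> ennreal (\<epsilon> * (1/2)^Suc n)" for n
    using assms[of n] \<open>\<epsilon> > 0\<close> unfolding hausdorff1_null_iff by simp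
  then obtain U :: "nat \<Rightarrow> nat \<Rightarrow> 'a set" where U: "\<And>n. A n \<subseteq> (\<Union>i. U n i)"
      "\<And>n i. bounded (U n i)"
      "\<And>n. (\<Sum>i. ennreal (diameter (U n i))) \<le> ennreal (\<epsilon> * (1/2)^Suc n)"
    by metis
  let ?V = "\<lambda>i. case prod_decode i of (n, k) \<Rightarrow> U n k"
  have "(\<Union>n. A n) \<subseteq> (\<Union>i. ?V i)"
  proof clarify
    fix x n assume "x \<in> A n"
    then obtain k where "x \<in> U n k" using U(1) by blast
    then have "x \<in> ?V (prod_encode (n, k))" by simp
    then show "x \<in> (\<Union>i. ?V i)" by (rule UN_I[OF UNIV_I])
  qed
  moreover have "\<forall>i. bounded (?V i)"
    using U(2) by (simp split: prod.split)
  moreover have "(\<Sum>i. ennreal (diameter (?V i))) \<le> ennreal \<epsilon>"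
  proof -
    have "(\<Sum>i. ennreal (diameter (?V i)))
        = (\<Sum>i. (\<lambda>(n, k). ennreal (diameter (U n k))) (prod_decode i))"
      by (simp add: case_prod_unfold)
    also have "\<dots> = (\<Sum>n. \<Sum>k. ennreal (diameter (U n k)))"
      by (rule suminf_ennreal_2dimen) simp
    also have "\<dots> \<le> (\<Sum>n. ennreal (\<epsilon> * (1/2)^Suc n))"
      by (intro suminf_le U(3)) auto
    also have "\<dots> = ennreal \<epsilon>"
    proof (rule suminf_ennreal_eq)
      show "0 \<le> \<epsilon> * (1/2)^Suc n" for n using \<open>\<epsilon> > 0\<close> by simp
      show "(\<lambda>n. \<epsilon> * (1/2)^Suc n) sums \<epsilon>"
        using sums_mult[OF power_half_series, of \<epsilon>] by simp
    qed
    finally show ?thesis .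
  qed
  ultimately show "\<exists>U::nat \<Rightarrow> 'a set. (\<Union>n. A n) \<subseteq> (\<Union>i. U i) \<and> (\<forall>i. bounded (U i)) \<and>
       (\<Sum>i. ennreal (diameter (U i))) \<le> ennreal \<epsilon>"
    by (intro exI[of _ ?V] conjI)
qed

lemma hausdorff1_null_UN:
  assumes "countable I" "\<And>i. i \<in> I \<Longrightarrow> hausdorff1 (A i) = 0"
  shows "hausdorff1 (\<Union>i\<in>I. A i) = 0"
proof (cases "I = {}")
  case True
  then show ?thesis
    using hausdorff1_null_iff[of "{}"] by (auto intro!: exI[of _ "\<lambda>_. {}"])
next
  case False
  then have "(\<Union>i\<in>I. A i) = (\<Union>n. A (from_nat_into I n))"
    using assms(1) by (metis UN_extend_simps(10) range_from_nat_into)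
  moreover have "hausdorff1 (\<Union>n. A (from_nat_into I n)) = 0"
    by (rule hausdorff1_null_UN_nat) (simp add: assms(2) False from_nat_into)
  ultimately show ?thesis by simp
qed

text \<open>
  The covers built below are indexed by countable families of intervals, which may be finite, and
  their diameters are controlled through finite subfamilies.  Indices \<open>n\<close> that enumerate
  no member of the family contribute the empty set.
\<close>

lemma hausdorff1_null_if_covers:
  fixes A :: "'a::metric_space set"
  assumes "\<And>\<epsilon>. \<epsilon> > 0 \<Longrightarrow> \<exists>(I::'i set) W. countable I \<and> A \<subseteq> (\<Union>i\<in>I. W i) \<and> (\<forall>i\<in>I. bounded (W i)) \<and>
     (\<forall>F. finite F \<longrightarrow> F \<subseteq> I \<longrightarrow> (\<Sum>i\<in>F. diameter (W i)) \<le> \<epsilon>)"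
  shows "hausdorff1 A = 0"
  unfolding hausdorff1_null_iff
proof (intro allI impI)
  fix \<epsilon> :: real assume "\<epsilon> > 0"
  then obtain I :: "'i set" and W where I: "countable I" "A \<subseteq> (\<Union>i\<in>I. W i)"
      "\<And>i. i \<in> I \<Longrightarrow> bounded (W i)"
    and sum: "\<And>F. finite F \<Longrightarrow> F \<subseteq> I \<Longrightarrow> (\<Sum>i\<in>F. diameter (W i)) \<le> \<epsilon>"
    using assms[of \<epsilon>] by metis
  let ?U = "\<lambda>n. if n \<in> to_nat_on I ` I then W (from_nat_into I n) else {}"
  have "A \<subseteq> (\<Union>n. ?U n)"
  proof
    fix x assume "x \<in> A"
    then obtain i where i: "i \<in> I" "x \<in> W i" using I by blast
    then have "x \<in> ?U (to_nat_on I i)" using I(1) by simp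
    then show "x \<in> (\<Union>n. ?U n)" by (rule UN_I[OF UNIV_I])
  qed
  moreover have "\<forall>n. bounded (?U n)"
    using I by auto
  moreover have "(\<Sum>n. ennreal (diameter (?U n))) \<le> ennreal \<epsilon>"
  proof (rule suminf_le_const)
    fix n
    let ?N = "{..<n} \<inter> to_nat_on I ` I"
    have "(\<Sum>k<n. ennreal (diameter (?U k))) = ennreal (\<Sum>k<n. diameter (?U k))"
      by (rule sum_ennreal) (use I in \<open>auto intro: diameter_ge_0\<close>)
    also have "(\<Sum>k<n. diameter (?U k)) = (\<Sum>k\<in>?N. diameter (W (from_nat_into I k)))"
      by (rule sum.mono_neutral_cong_right) auto
    also have "\<dots> = (\<Sum>i\<in>from_nat_into I ` ?N. diameter (W i))"
    proof (subst sum.reindex)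
      show "inj_on (from_nat_into I) ?N"
        using I(1) by (auto intro!: inj_onI)
    qed simp
    also have "\<dots> \<le> \<epsilon>"
      using I(1) by (intro sum) auto
    finally show "(\<Sum>k<n. ennreal (diameter (?U k))) \<le> ennreal \<epsilon>"
      by (simp add: ennreal_leI)
  qed simp
  ultimately show "\<exists>U::nat \<Rightarrow> 'a set. A \<subseteq> (\<Union>i. U i) \<and> (\<forall>i. bounded (U i)) \<and>
       (\<Sum>i. ennreal (diameter (U i))) \<le> ennreal \<epsilon>"
    by (intro exI[of _ ?U] conjI)
qed

lemma hausdorff1_null_imp_negligible:
  fixes A :: "real set"
  assumes "hausdorff1 A = 0"
  shows "negligible A"
  unfolding negligible_outer_le
proof (intro allI impI)
  fix e :: real assume "e > 0"
  then have "e/2 > 0" by simp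
  then obtain U :: "nat \<Rightarrow> real set" where U: "A \<subseteq> (\<Union>i. U i)" "\<And>i. bounded (U i)"
    and s: "(\<Sum>i. ennreal (diameter (U i))) \<le> ennreal (e/2)"
    using assms unfolding hausdorff1_null_iff by meson
  have "\<exists>c. U i \<subseteq> cball c (diameter (U i))" for i
  proof (cases "U i = {}")
    case False
    then obtain c where "c \<in> U i" by blast
    then show ?thesis using diameter_bounded_bound[OF U(2)] by (auto simp: subset_iff)
  qed auto
  then obtain c where c: "\<And>i. U i \<subseteq> cball (c i) (diameter (U i))"
    by metis
  let ?T = "\<Union>i. cball (c i) (diameter (U i))"
  have "emeasure lebesgue ?T \<le> (\<Sum>i. emeasure lebesgue (cball (c i) (diameter (U i))))"
    by (rule emeasure_subadditive_countably) auto
  also have "\<dots> = (\<Sum>i. 2 * ennreal (diameter (U i)))"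
    by (rule suminf_cong)
      (simp add: cball_eq_atLeastAtMost diameter_ge_0 U(2) flip: ennreal_mult'' ennreal_numeral)
  also have "\<dots> = 2 * (\<Sum>i. ennreal (diameter (U i)))"
    by simp
  also have "\<dots> \<le> 2 * ennreal (e/2)"
    using s by (rule mult_left_mono) simp
  also have "\<dots> = ennreal e"
    using \<open>e > 0\<close> by (simp flip: ennreal_mult'' ennreal_numeral)
  finally have *: "emeasure lebesgue ?T \<le> ennreal e" .
  have T: "?T \<in> lmeasurable"
    using * by (intro fmeasurableI) (auto simp: order_le_less_trans[OF _ ennreal_less_top])
  moreover have "measure lebesgue ?T \<le> e"
    using * \<open>e > 0\<close> T by (simp add: emeasure_eq_measure2)
  moreover have "A \<subseteq> ?T"
    using U(1) UN_mono[of UNIV UNIV U, OF _ c] by (rule order_trans) simp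
  ultimately show "\<exists>T. A \<subseteq> T \<and> T \<in> lmeasurable \<and> measure lebesgue T \<le> e"
    by (intro exI[of _ ?T] conjI)
qed

section \<open>Lipschitz functions that map a measurable set to a null set\<close>

text \<open>
  The last property comes from additivity of measure over the almost disjoint intervals of the cover, with a
  measurable set \<open>Y\<close> removed from each.  With \<open>Y = {}\<close> it bounds total
  length; with \<open>Y\<close> the covered set it bounds the total excess of the intervals over
  that set.
\<close>

lemma outer_intervals_real:
  fixes X :: "real set"
  assumes "X \<in> lmeasurable" "X \<subseteq> {a..b}" "e > 0"
  obtains D where "countable D" "\<And>I. I \<in> D \<Longrightarrow> \<exists>c d. c \<le> d \<and> I = {c..d}"
    "X \<subseteq> \<Union>D" "\<Union>D \<in> lmeasurable" "measure lebesgue (\<Union>D) \<le> measure lebesgue X + e"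
    "\<And>F Y. finite F \<Longrightarrow> F \<subseteq> D \<Longrightarrow> Y \<in> sets lebesgue \<Longrightarrow>
      (\<Sum>I\<in>F. measure lebesgue (I - Y)) \<le> measure lebesgue (\<Union>D - Y)"
proof -
  obtain D where D: "countable D" 
    "\<And>K. K \<in> D \<Longrightarrow> K \<subseteq> cbox a b \<and> K \<noteq> {} \<and> (\<exists>c d. K = cbox c d)"
    "pairwise (\<lambda>A B. interior A \<inter> interior B = {}) D"
    "X \<subseteq> \<Union>D" "\<Union>D \<in> lmeasurable" "measure lebesgue (\<Union>D) \<le> measure lebesgue X + e"
    by (rule measurable_outer_intervals_bounded[of X a b e]) (use assms in auto)
  have int: "\<exists>c d. c \<le> d \<and> I = {c..d}" if I: "I \<in> D" for I
  proof -
    obtain c d where "I = cbox c d" "I \<noteq> {}" using D(2)[OF I] by blast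
    then show ?thesis by (intro exI[of _ c] exI[of _ d]) auto
  qed
  show thesis
  proof (rule that[OF D(1) int D(4-6)])
    fix F :: "real set set" and Y :: "real set"
    assume F: "finite F" "F \<subseteq> D" and Y: "Y \<in> sets lebesgue"
    have meas: "I - Y \<in> lmeasurable" if "I \<in> F" for I
    proof (rule fmeasurable_Diff)
      show "I \<in> lmeasurable" using int F that by fastforce
    qed (rule Y)
    have "(\<Sum>I\<in>F. measure lebesgue (I - Y)) = measure lebesgue (\<Union>I\<in>F. I - Y)"
    proof (rule measure_negligible_finite_Union_image[symmetric])
      show "pairwise (\<lambda>A B. negligible ((A - Y) \<inter> (B - Y))) F"
      proof (rule pairwiseI)
        fix A B assume AB: "A \<in> F" "B \<in> F" "A \<noteq> B"
        then have "interior (A \<inter> B) = {}"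
          using pairwiseD[OF D(3), of A B] F by (simp add: subset_iff)
        moreover have "convex (A \<inter> B)"
          using int AB F by (intro convex_Int) (fastforce simp: subset_iff)+
        ultimately have "negligible (A \<inter> B)"
          by (simp add: negligible_convex_interior)
        then show "negligible ((A - Y) \<inter> (B - Y))"
          by (rule negligible_subset) auto
      qed
    qed (use F meas in auto)
    also have "\<dots> \<le> measure lebesgue (\<Union>D - Y)"
      by (rule measure_mono_fmeasurable) (use F fmeasurable_Diff[OF D(5) Y] meas fmeasurableD in blast)+
    finally show "(\<Sum>I\<in>F. measure lebesgue (I - Y)) \<le> measure lebesgue (\<Union>D - Y)" .
  qed
qed

text \<open>
  An interval of length \<open>l\<close> is mapped into one of length \<open>L * l\<close>, centred at
  the value of the midpoint, so a tight cover of \<open>X\<close> by intervals gives \<open>W\<close>.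
\<close>

lemma lipschitz_image_outer_measure:
  fixes u :: "real \<Rightarrow> real"
  assumes u: "L-lipschitz_on UNIV u" and X: "X \<in> lmeasurable" "X \<subseteq> {a..b}" and "e > 0"
  obtains W where "u ` X \<subseteq> W" "W \<in> lmeasurable" "measure lebesgue W \<le> L * measure lebesgue X + e"
proof -
  have L: "L \<ge> 0" using u lipschitz_on_nonneg by blast
  have "e / (L + 1) > 0" using L \<open>e > 0\<close> by simp
  then obtain D where D: "countable D" "\<And>I. I \<in> D \<Longrightarrow> \<exists>c d. c \<le> d \<and> I = {c..d}"
    "X \<subseteq> \<Union>D" "\<Union>D \<in> lmeasurable" "measure lebesgue (\<Union>D) \<le> measure lebesgue X + e / (L + 1)"
    "\<And>F Y. finite F \<Longrightarrow> F \<subseteq> D \<Longrightarrow> Y \<in> sets lebesgue \<Longrightarrow>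
      (\<Sum>I\<in>F. measure lebesgue (I - Y)) \<le> measure lebesgue (\<Union>D - Y)"
    using outer_intervals_real[OF X] by metis
  have "\<exists>x y. u ` I \<subseteq> {x..y} \<and> measure lebesgue {x..y} \<le> L * measure lebesgue I" if I: "I \<in> D" for I
  proof -
    obtain c d where cd: "c \<le> d" "I = {c..d}" using D(2)[OF I] by blast
    let ?m = "(c + d) / 2" and ?r = "(d - c) / 2"
    have "\<bar>u t - u ?m\<bar> \<le> L * ?r" if "t \<in> I" for t
    proof -
      have "\<bar>u t - u ?m\<bar> \<le> L * \<bar>t - ?m\<bar>"
        using lipschitz_onD[OF u, of t ?m] by (simp add: dist_real_def)
      also have "\<dots> \<le> L * ?r"
        using L that cd by (intro mult_left_mono) (auto simp: abs_le_iff field_simps)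
      finally show ?thesis .
    qed
    then have "u t \<in> {u ?m - L * ?r..u ?m + L * ?r}" if "t \<in> I" for t
      unfolding atLeastAtMost_iff using that by (meson abs_diff_le_iff)
    then have "u ` I \<subseteq> {u ?m - L * ?r..u ?m + L * ?r}"
      by blast
    moreover have "measure lebesgue {u ?m - L * ?r..u ?m + L * ?r} \<le> L * measure lebesgue I"
      using cd L mult_left_mono[of c d L] by (simp add: field_simps)
    ultimately show ?thesis by blast
  qed
  then obtain x y where xy: "\<And>I. I \<in> D \<Longrightarrow> u ` I \<subseteq> {x I..y I}"
     "\<And>I. I \<in> D \<Longrightarrow> measure lebesgue {x I..y I} \<le> L * measure lebesgue I"
    by metis
  let ?W = "\<Union>I\<in>D. {x I..y I}"
  have bd: "measure lebesgue (\<Union>I\<in>F. {x I..y I}) \<le> L * measure lebesgue X + e"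
    if F: "F \<subseteq> D" "finite F" for F
  proof -
    have "measure lebesgue (\<Union>I\<in>F. {x I..y I}) \<le> (\<Sum>I\<in>F. measure lebesgue {x I..y I})"
      by (rule measure_UNION_le) (use F in auto)
    also have "\<dots> \<le> (\<Sum>I\<in>F. L * measure lebesgue I)"
      using xy(2) F by (intro sum_mono) blast
    also have "\<dots> = L * (\<Sum>I\<in>F. measure lebesgue I)"
      by (simp add: sum_distrib_left)
    also have "\<dots> \<le> L * measure lebesgue (\<Union>D)"
      using D(6)[OF F(2,1), of "{}"] L by (auto intro: mult_left_mono)
    also have "\<dots> \<le> L * (measure lebesgue X + e / (L + 1))"
      using D(5) L by (rule mult_left_mono)
    also have "\<dots> \<le> L * measure lebesgue X + e"
      using L \<open>e > 0\<close> by (simp add: field_simps)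
    finally show ?thesis .
  qed
  show thesis
  proof (rule that)
    show "u ` X \<subseteq> ?W"
    proof clarify
      fix t assume "t \<in> X"
      then obtain I where "I \<in> D" "t \<in> I" using D(3) by (auto dest: subsetD)
      then show "u t \<in> ?W" using xy(1)[of I] by (intro UN_I[of I]) (simp_all add: image_subset_iff)
    qed
    show "?W \<in> lmeasurable"
      by (rule fmeasurable_UN_bound[OF D(1) _ bd]) simp_all
    show "measure lebesgue ?W \<le> L * measure lebesgue X + e"
      by (rule measure_UN_bound[OF D(1) _ bd]) simp_all
  qed
qed

text \<open>
  This is an integrated form of the statement that \<open>u\<close> has derivative zero almost
  everywhere on \<open>K\<close>.  By the intermediate value theorem the
  interval between \<open>u s\<close> and \<open>u t\<close> lies in \<open>u ` {a..b}\<close>.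
  The part of that image coming from \<open>K\<close> is null, and the remaining part has outer
  measure at most \<open>L\<close> times the measure of \<open>{a..b} - K\<close>.
\<close>

lemma lipschitz_increment_le:
  fixes u :: "real \<Rightarrow> real"
  assumes u: "L-lipschitz_on UNIV u" and K: "K \<in> sets lebesgue" and null: "negligible (u ` K)"
    and st: "s \<in> {a..b}" "t \<in> {a..b}"
  shows "\<bar>u s - u t\<bar> \<le> L * measure lebesgue ({a..b} - K)"
proof (rule field_le_epsilon)
  fix e :: real assume "e > 0"
  have "{a..b} - K \<in> lmeasurable"
    using K by (intro fmeasurable_Diff) auto
  then obtain W where W: "u ` ({a..b} - K) \<subseteq> W" "W \<in> lmeasurable"
      "measure lebesgue W \<le> L * measure lebesgue ({a..b} - K) + e"
    using lipschitz_image_outer_measure[OF u _ _ \<open>e > 0\<close>] by (metis Diff_subset)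
  have "connected (u ` {a..b})"
    by (intro connected_continuous_image continuous_on_subset[OF lipschitz_on_continuous_on[OF u]]) auto
  then have "{min (u s) (u t)..max (u s) (u t)} \<subseteq> u ` {a..b}"
    using st by (intro connected_contains_Icc) (auto simp: min_def max_def)
  also have "\<dots> \<subseteq> u ` K \<union> W" using W(1) by blast
  finally have sub: "{min (u s) (u t)..max (u s) (u t)} \<subseteq> u ` K \<union> W" .
  have m: "u ` K \<in> lmeasurable" "measure lebesgue (u ` K) = 0"
    using null negligible_iff_measure by auto
  have "\<bar>u s - u t\<bar> = measure lebesgue {min (u s) (u t)..max (u s) (u t)}"
    by auto
  also have "\<dots> \<le> measure lebesgue (u ` K \<union> W)"
    using sub by (rule measure_mono_fmeasurable) (use m W in auto)
  also have "\<dots> \<le> measure lebesgue (u ` K) + measure lebesgue W"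
    by (rule measure_Un_le) (use m W in auto)
  finally show "\<bar>u s - u t\<bar> \<le> L * measure lebesgue ({a..b} - K) + e"
    using m W by simp
qed

text \<open>
  The functions \<open>\<phi> p\<close> play the role of coordinates on \<open>S\<close> whose inverse
  is Lipschitz.  On an interval \<open>I\<close> each coordinate of the curve oscillates by at most
  \<open>L\<close> times the measure of \<open>I - K\<close>, hence the part of \<open>S\<close> traced
  over \<open>I \<inter> K\<close> has diameter at most a constant times that measure.  Summed over
  an almost disjoint cover of \<open>K\<close> by intervals of total length close to the measure of
  \<open>K\<close>, these excess measures are as small as desired.
\<close>

lemma hausdorff1_null_on_lipschitz_curve:
  fixes f :: "real \<Rightarrow> 'a::real_normed_vector" and \<phi> :: "'p \<Rightarrow> 'a \<Rightarrow> real"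
  assumes "finite P"
    and lip: "\<And>p. p \<in> P \<Longrightarrow> L-lipschitz_on UNIV (\<lambda>t. \<phi> p (f t))"
    and null: "\<And>p. p \<in> P \<Longrightarrow> negligible ((\<lambda>t. \<phi> p (f t)) ` K)"
    and K: "K \<in> lmeasurable" "K \<subseteq> {a..b}"
    and S: "S \<subseteq> f ` K"
    and "0 \<le> C"
    and inv: "\<And>z w. z \<in> S \<Longrightarrow> w \<in> S \<Longrightarrow> norm (z - w) \<le> C * (\<Sum>p\<in>P. \<bar>\<phi> p z - \<phi> p w\<bar>)"
  shows "hausdorff1 S = 0"
proof (rule hausdorff1_null_if_covers)
  fix e :: real assume "e > 0"
  \<comment> \<open>the parts of the curve over \<open>I\<close> will have diameter at most \<open>M\<close> times the measure of \<open>I - K\<close>\<close>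
  define M where "M = C * (card P * L)"
  have M: "0 \<le> M"
  proof (cases "P = {}")
    case False
    then have "0 \<le> L" using lip lipschitz_on_nonneg by blast
    then show ?thesis using \<open>0 \<le> C\<close> by (simp add: M_def)
  qed (simp add: M_def)
  then have "e / (M + 1) > 0" using \<open>e > 0\<close> by simp
  then obtain D where D: "countable D" "\<And>I. I \<in> D \<Longrightarrow> \<exists>c d. c \<le> d \<and> I = {c..d}"
    "K \<subseteq> \<Union>D" "\<Union>D \<in> lmeasurable" "measure lebesgue (\<Union>D) \<le> measure lebesgue K + e / (M + 1)"
    "\<And>F Y. finite F \<Longrightarrow> F \<subseteq> D \<Longrightarrow> Y \<in> sets lebesgue \<Longrightarrow>
      (\<Sum>I\<in>F. measure lebesgue (I - Y)) \<le> measure lebesgue (\<Union>D - Y)"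
    using outer_intervals_real[OF K] by metis
  have KL: "K \<in> sets lebesgue" using K by blast
  let ?W = "\<lambda>I. f ` (K \<inter> I) \<inter> S"
  have near: "norm (z - w) \<le> M * measure lebesgue (I - K)"
    if I: "I \<in> D" and z: "z \<in> ?W I" and w: "w \<in> ?W I" for I z w
  proof -
    obtain c d where cd: "I = {c..d}" using D(2)[OF I] by blast
    obtain s t where st: "s \<in> I" "z = f s" "t \<in> I" "w = f t" using z w by blast
    have "norm (z - w) \<le> C * (\<Sum>p\<in>P. \<bar>\<phi> p z - \<phi> p w\<bar>)"
      using z w by (intro inv) auto
    also have "\<dots> \<le> C * (\<Sum>p\<in>P. L * measure lebesgue (I - K))"
    proof (intro mult_left_mono sum_mono)
      fix p assume "p \<in> P"
      then show "\<bar>\<phi> p z - \<phi> p w\<bar> \<le> L * measure lebesgue (I - K)"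
        using lipschitz_increment_le[OF lip KL null, of p s c d t] st cd by simp
    qed (rule \<open>0 \<le> C\<close>)
    also have "\<dots> = M * measure lebesgue (I - K)"
      by (simp add: M_def)
    finally show ?thesis .
  qed
  have "\<forall>I\<in>D. bounded (?W I)"
  proof
    fix I assume "I \<in> D"
    then show "bounded (?W I)"
      unfolding bounded_two_points dist_norm using near by blast
  qed
  moreover have "S \<subseteq> (\<Union>I\<in>D. ?W I)"
  proof
    fix z assume "z \<in> S"
    then obtain t where t: "t \<in> K" "z = f t" using S by auto
    then obtain I where "I \<in> D" "t \<in> I" using D(3) by (meson UnionE subsetD)
    then show "z \<in> (\<Union>I\<in>D. ?W I)" using t \<open>z \<in> S\<close> by (intro UN_I[of I]) auto
  qed
  moreover have "(\<Sum>I\<in>F. diameter (?W I)) \<le> e" if F: "finite F" "F \<subseteq> D" for F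
  proof -
    have "(\<Sum>I\<in>F. diameter (?W I)) \<le> (\<Sum>I\<in>F. M * measure lebesgue (I - K))"
    proof (rule sum_mono)
      fix I assume "I \<in> F"
      then have I: "I \<in> D" using F by blast
      show "diameter (?W I) \<le> M * measure lebesgue (I - K)"
        by (rule diameter_le[OF _ near[OF I]]) (use M in simp)
    qed
    also have "\<dots> = M * (\<Sum>I\<in>F. measure lebesgue (I - K))"
      by (simp add: sum_distrib_left)
    also have "\<dots> \<le> M * measure lebesgue (\<Union>D - K)"
      using D(6)[OF F KL] M by (rule mult_left_mono)
    also have "measure lebesgue (\<Union>D - K) = measure lebesgue (\<Union>D) - measure lebesgue K"
      using D(3,4) K(1) by (intro measurable_measure_Diff) auto
    also have "M * \<dots> \<le> M * (e / (M + 1))"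
      using D(5) M by (intro mult_left_mono) auto
    also have "\<dots> \<le> e"
      using M \<open>e > 0\<close> by (simp add: field_simps)
    finally show ?thesis .
  qed
  ultimately show "\<exists>(I::real set set) W. countable I \<and> S \<subseteq> (\<Union>i\<in>I. W i) \<and>
     (\<forall>i\<in>I. bounded (W i)) \<and>
     (\<forall>F. finite F \<longrightarrow> F \<subseteq> I \<longrightarrow> (\<Sum>i\<in>F. diameter (W i)) \<le> e)"
    using D(1) by (intro exI[of _ D] exI[of _ ?W]) simp
qed

section \<open>Distances to pins as coordinates\<close>

text \<open>
  The sum on the right is a norm, because a vector orthogonal to a spanning set vanishes; its
  minimum on the unit sphere is therefore positive, and \<open>C\<close> is the reciprocal of that
  minimum.
\<close>

lemma norm_le_sum_inner_spanning:
  fixes n :: "'a::euclidean_space"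
  assumes "finite P" and span: "span (insert n (v ` P)) = UNIV"
  obtains C where "0 \<le> C" "\<And>x. norm x \<le> C * (\<bar>x \<bullet> n\<bar> + (\<Sum>p\<in>P. \<bar>x \<bullet> v p\<bar>))"
proof -
  let ?g = "\<lambda>x. \<bar>x \<bullet> n\<bar> + (\<Sum>p\<in>P. \<bar>x \<bullet> v p\<bar>)"
  have "continuous_on (sphere 0 1) ?g"
    by (intro continuous_intros)
  then obtain x0 where x0: "x0 \<in> sphere 0 1" "\<And>x. x \<in> sphere 0 1 \<Longrightarrow> ?g x0 \<le> ?g x"
    using continuous_attains_inf[of "sphere 0 1" ?g] by auto
  have nonneg: "?g x \<ge> 0" for x
    by (intro add_nonneg_nonneg sum_nonneg) auto
  have "?g x0 \<noteq> 0"
  proof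
    assume "?g x0 = 0"
    moreover have "0 \<le> (\<Sum>p\<in>P. \<bar>x0 \<bullet> v p\<bar>)" by (rule sum_nonneg) simp
    ultimately have "x0 \<bullet> n = 0" and "(\<Sum>p\<in>P. \<bar>x0 \<bullet> v p\<bar>) = 0" by linarith+
    then have "\<forall>y \<in> insert n (v ` P). orthogonal x0 y"
      using \<open>finite P\<close> by (simp add: sum_nonneg_eq_0_iff orthogonal_def)
    then have "orthogonal x0 x0"
      using span by (intro orthogonal_to_span[of x0 "insert n (v ` P)"]) auto
    then show False using x0(1) by (simp add: orthogonal_def)
  qed
  then have pos: "?g x0 > 0" using nonneg[of x0] by linarith
  show thesis
  proof (rule that[of "1 / ?g x0"])
    show "0 \<le> 1 / ?g x0" using pos by simp
    show "norm x \<le> 1 / ?g x0 * ?g x" for x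
    proof (cases "x = 0")
      case False
      have "?g x0 \<le> ?g (x /\<^sub>R norm x)"
        by (rule x0(2)) (use False in simp)
      also have "\<dots> = ?g x / norm x"
        by (simp add: abs_mult sum_distrib_left add_divide_distrib divide_inverse algebra_simps
              flip: sum_distrib_left)
      finally show ?thesis using pos False by (simp add: field_simps)
    qed (use pos in simp)
  qed
qed

text \<open>
  Squared distances to the pins are as good as distances on a bounded set.  Their differences
  between two pins are affine and recover the component of a point along the span of the
  \<open>p - p0\<close>; the squared distance to \<open>p0\<close> itself then recovers the square of
  the height \<open>(z - p0) \<bullet> n\<close> above the hyperplane of the pins.  The hypothesis
  \<open>sep\<close> says that on \<open>T\<close> passing from the squared height to the height costs
  only the factor \<open>1 / c\<close>: it holds on one side of the hyperplane, at height at
  least \<open>c / 2\<close>, and also inside the hyperplane, where the height is constant.  The value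
  \<open>n = 0\<close> covers pins that affinely span the whole space.
\<close>

lemma norm_diff_le_sum_distance_diffs:
  fixes n p0 :: "'a::euclidean_space"
  assumes P: "finite P" "p0 \<in> P"
    and span: "span (insert n ((\<lambda>p. p - p0) ` P)) = UNIV"
    and orth: "\<And>p. p \<in> P \<Longrightarrow> n \<bullet> (p - p0) = 0"
    and n: "n = 0 \<or> norm n = 1"
    and T: "\<And>z. z \<in> T \<Longrightarrow> norm z \<le> m"
    and "c > 0"
    and sep: "\<And>z w. z \<in> T \<Longrightarrow> w \<in> T \<Longrightarrow>
      (z - p0) \<bullet> n = (w - p0) \<bullet> n \<or> c \<le> \<bar>(z - p0) \<bullet> n + (w - p0) \<bullet> n\<bar>"
  obtains C where "0 \<le> C" "\<And>z w. z \<in> T \<Longrightarrow> w \<in> T \<Longrightarrow>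
      norm (z - w) \<le> C * (\<Sum>p\<in>P. \<bar>norm (z - p) - norm (w - p)\<bar>)"
proof -
  obtain C0 where C0: "0 \<le> C0"
      "\<And>x. norm x \<le> C0 * (\<bar>x \<bullet> n\<bar> + (\<Sum>p\<in>P. \<bar>x \<bullet> (p - p0)\<bar>))"
    using norm_le_sum_inner_spanning[OF P(1) span] by blast
  \<comment> \<open>\<open>R\<close> bounds all distances between \<open>T\<close> and the pins\<close>
  define R where "R = \<bar>m\<bar> + (\<Sum>p\<in>P. norm p)"
  have R: "norm (z - p) \<le> R" if "z \<in> T" "p \<in> P" for z p
  proof -
    have "norm (z - p) \<le> norm z + norm p" by (rule norm_triangle_ineq4)
    also have "norm p \<le> (\<Sum>p\<in>P. norm p)"
      using P(1) that(2) by (intro member_le_sum) auto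
    finally show ?thesis using T[OF that(1)] by (simp add: R_def)
  qed
  have R0: "0 \<le> R" unfolding R_def by (intro add_nonneg_nonneg sum_nonneg) auto
  define A where "A = C0 * (card P * (2 * R))"
  have A: "0 \<le> A" using C0 R0 by (simp add: A_def)
  define C where "C = A + (2 * R + A * (2 * R)) / c"
  have "norm (z - w) \<le> C * (\<Sum>p\<in>P. \<bar>norm (z - p) - norm (w - p)\<bar>)"
    if zw: "z \<in> T" "w \<in> T" for z w
  proof -
    let ?x = "z - w"
    define S where "S = (\<Sum>p\<in>P. \<bar>norm (z - p) - norm (w - p)\<bar>)"
    have S0: "0 \<le> S" unfolding S_def by (rule sum_nonneg) simp
    define \<delta> where "\<delta> p = (norm (z - p))\<^sup>2 - (norm (w - p))\<^sup>2" for p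
    have \<delta>: "\<bar>\<delta> p\<bar> \<le> 2 * R * S" if p: "p \<in> P" for p
    proof -
      have "\<bar>\<delta> p\<bar> = (norm (z - p) + norm (w - p)) * \<bar>norm (z - p) - norm (w - p)\<bar>"
        unfolding \<delta>_def power2_eq_square square_diff_square_factored abs_mult by simp
      also have "\<dots> \<le> (2 * R) * S"
      proof (rule mult_mono)
        show "norm (z - p) + norm (w - p) \<le> 2 * R"
          using R[OF zw(1) p] R[OF zw(2) p] by simp
        show "\<bar>norm (z - p) - norm (w - p)\<bar> \<le> S"
          unfolding S_def using P(1) p by (intro member_le_sum) auto
      qed (use R0 in simp_all)
      finally show ?thesis .
    qed
    have inner_p: "\<bar>?x \<bullet> (p - p0)\<bar> \<le> 2 * R * S" if p: "p \<in> P" for p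
    proof -
      have "2 * (?x \<bullet> (p - p0)) = \<delta> p0 - \<delta> p"
        unfolding \<delta>_def power2_norm_eq_inner by (simp add: algebra_simps inner_commute)
      then show ?thesis using \<delta>[OF p] \<delta>[OF P(2)] by linarith
    qed
    \<comment> \<open>the component of the displacement along the span of the \<open>p - p0\<close>\<close>
    define x' where "x' = ?x - (?x \<bullet> n) *\<^sub>R n"
    have nn: "x' \<bullet> n = 0"
      using n by (auto simp: x'_def inner_diff_left norm_eq_1)
    have "x' \<bullet> (p - p0) = ?x \<bullet> (p - p0)" if "p \<in> P" for p
      unfolding x'_def inner_diff_left[of ?x] inner_scaleR_left orth[OF that] by simp
    then have "norm x' \<le> C0 * (\<Sum>p\<in>P. \<bar>?x \<bullet> (p - p0)\<bar>)"
      using C0(2)[of x'] nn by simp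
    also have "\<dots> \<le> C0 * (\<Sum>p\<in>P. 2 * R * S)"
      using C0(1) inner_p by (intro mult_left_mono sum_mono)
    also have "\<dots> = A * S" by (simp add: A_def)
    finally have x': "norm x' \<le> A * S" .
    define y where "y = (z - p0) + (w - p0)"
    have y: "norm y \<le> 2 * R"
      using norm_triangle_ineq[of "z - p0" "w - p0"] R[OF zw(1) P(2)] R[OF zw(2) P(2)]
      by (simp add: y_def)
    \<comment> \<open>difference of two squares, split along \<open>n\<close>; \<open>y \<bullet> n\<close> is the sum of the two heights\<close>
    have "\<delta> p0 = ?x \<bullet> y"
      unfolding \<delta>_def y_def power2_norm_eq_inner by (simp add: algebra_simps inner_commute)
    also have "\<dots> = x' \<bullet> y + (?x \<bullet> n) * (y \<bullet> n)"
      unfolding x'_def by (simp add: inner_diff_left inner_diff_right inner_commute algebra_simps)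
    finally have "\<bar>(?x \<bullet> n) * (y \<bullet> n)\<bar> \<le> \<bar>\<delta> p0\<bar> + \<bar>x' \<bullet> y\<bar>" by linarith
    moreover have "\<bar>x' \<bullet> y\<bar> \<le> A * S * (2 * R)"
      using Cauchy_Schwarz_ineq2[of x' y] mult_mono[OF x' y] A S0 by simp
    ultimately have "\<bar>(?x \<bullet> n) * (y \<bullet> n)\<bar> \<le> 2 * R * S + A * S * (2 * R)"
      using \<delta>[OF P(2)] by linarith
    also have "\<dots> = (2 * R + A * (2 * R)) * S" by (simp add: algebra_simps)
    finally have h: "\<bar>?x \<bullet> n\<bar> * \<bar>y \<bullet> n\<bar> \<le> (2 * R + A * (2 * R)) * S"
      by (simp only: abs_mult)
    have "\<bar>?x \<bullet> n\<bar> * c \<le> \<bar>?x \<bullet> n\<bar> * \<bar>y \<bullet> n\<bar>"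
    proof (cases "?x \<bullet> n = 0")
      case False
      then have "(z - p0) \<bullet> n \<noteq> (w - p0) \<bullet> n" by (simp add: inner_diff_left)
      then have "c \<le> \<bar>y \<bullet> n\<bar>" using sep[OF zw] by (simp add: y_def inner_add_left)
      then show ?thesis by (intro mult_left_mono) auto
    qed simp
    with h have xn: "\<bar>?x \<bullet> n\<bar> \<le> (2 * R + A * (2 * R)) / c * S"
      using \<open>c > 0\<close> by (simp add: field_simps)
    have "norm ?x \<le> norm x' + norm ((?x \<bullet> n) *\<^sub>R n)"
      using norm_triangle_ineq[of x' "(?x \<bullet> n) *\<^sub>R n"] by (simp add: x'_def)
    also have "norm ((?x \<bullet> n) *\<^sub>R n) \<le> \<bar>?x \<bullet> n\<bar>"
      using n by auto
    also have "norm x' + \<bar>?x \<bullet> n\<bar> \<le> C * S"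
      using x' xn by (simp add: C_def algebra_simps)
    finally show ?thesis by (simp add: S_def)
  qed
  moreover have "0 \<le> C" using A R0 \<open>c > 0\<close> by (simp add: C_def)
  ultimately show thesis using that by blast
qed

section \<open>Bad pins in general position\<close>

text \<open>
  The curve is cut into countably many pieces: parameters are restricted to bounded intervals,
  and points to bounded sets that lie in the hyperplane of the pins or on one side of it at a
  positive distance.  On each piece the distances to the pins are coordinates with Lipschitz
  inverse, and badness of the pins says that each coordinate takes only a null set of values.
\<close>

lemma hausdorff1_null_curve_if_bad_pins:
  fixes f :: "real \<Rightarrow> 'a::euclidean_space"
  assumes E: "E \<in> sets borel" and f: "L-lipschitz_on UNIV f"
    and P: "finite P" "P \<subseteq> bad_pins E" "p0 \<in> P"
    and dim: "DIM('a) \<le> Suc (dim ((\<lambda>p. p - p0) ` P))"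
  shows "hausdorff1 (E \<inter> range f) = 0"
proof -
  let ?V = "(\<lambda>p. p - p0) ` P"
  obtain n where n: "n = 0 \<or> norm n = 1" "\<And>p. p \<in> P \<Longrightarrow> n \<bullet> (p - p0) = 0"
    and span: "span (insert n ?V) = UNIV"
  proof (cases "dim ?V < DIM('a)")
    case True
    then obtain x where x: "x \<noteq> 0" "\<And>y. y \<in> span ?V \<Longrightarrow> orthogonal x y"
      using orthogonal_to_subspace_exists by blast
    let ?n = "x /\<^sub>R norm x"
    have "?n \<notin> span ?V"
    proof
      assume "?n \<in> span ?V"
      then have "orthogonal x ?n" by (rule x(2))
      then show False using x(1) by (simp add: orthogonal_def)
    qed
    then have "dim (insert ?n ?V) = Suc (dim ?V)" by (simp add: dim_insert)
    then have "span (insert ?n ?V) = UNIV"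
      using dim dim_subset_UNIV[of "insert ?n ?V"] by (intro dim_eq_full[THEN iffD1]) simp
    moreover have "?n \<bullet> (p - p0) = 0" if "p \<in> P" for p
      using x(2)[of "p - p0"] that by (simp add: orthogonal_def span_base)
    ultimately show thesis using x(1) by (intro that[of ?n]) auto
  next
    case False
    then have "span ?V = UNIV"
      using dim_subset_UNIV[of ?V] by (intro dim_eq_full[THEN iffD1]) simp
    then show thesis by (intro that[of 0]) auto
  qed
  define h where "h z = (z - p0) \<bullet> n" for z
  \<comment> \<open>\<open>s\<close> is the sign of the height: \<open>0\<close> for the hyperplane, \<open>1\<close> and \<open>-1\<close> for its sides\<close>
  define T where "T m s = {z. norm z \<le> real m \<and>
      (if s = 0 then h z = 0 else 1 / Suc m \<le> s * h z)}" for m :: nat and s :: real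
  define K where "K N = f -` E \<inter> {- real N..real N}" for N :: nat
  have "f -` E \<in> sets borel"
  proof -
    have "f \<in> borel_measurable borel"
      by (intro borel_measurable_continuous_onI lipschitz_on_continuous_on[OF f])
    then have "f -` E \<inter> space borel \<in> sets borel" using E by (rule measurable_sets)
    then show ?thesis by simp
  qed
  then have "f -` E \<in> sets lebesgue" by simp
  then have K: "K N \<in> lmeasurable" for N
    unfolding K_def Int_commute[of "f -` E"]
    by (intro fmeasurable_Int_fmeasurable lmeasurable_interval)
  have piece: "hausdorff1 (f ` K N \<inter> T m s) = 0" if s: "s \<in> {-1, 0, 1}" for N m s
  proof -
    obtain C where C: "0 \<le> C" "\<And>z w. z \<in> T m s \<Longrightarrow> w \<in> T m s \<Longrightarrow>
      norm (z - w) \<le> C * (\<Sum>p\<in>P. \<bar>norm (z - p) - norm (w - p)\<bar>)"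
    proof (rule norm_diff_le_sum_distance_diffs[OF P(1,3) span n(2,1), of "T m s" m "1 / Suc m"])
      fix z w assume "z \<in> T m s" "w \<in> T m s"
      then have "h z = h w \<or> 1 / Suc m \<le> \<bar>h z + h w\<bar>"
        using s by (auto simp: T_def simp del: of_nat_Suc)
      then show "(z - p0) \<bullet> n = (w - p0) \<bullet> n \<or> 1 / Suc m \<le> \<bar>(z - p0) \<bullet> n + (w - p0) \<bullet> n\<bar>"
        by (simp only: h_def)
    qed (auto simp: T_def)
    show ?thesis
    proof (rule hausdorff1_null_on_lipschitz_curve
        [where \<phi> = "\<lambda>p z. norm (z - p)" and f = f, OF P(1) _ _ K _ _ C(1)])
      show "L-lipschitz_on UNIV (\<lambda>t. norm (f t - p))" for p
      proof (rule lipschitz_onI)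
        fix x y
        have "dist (norm (f x - p)) (norm (f y - p)) \<le> dist (f x) (f y)"
          using norm_triangle_ineq3[of "f x - p" "f y - p"] by (simp add: dist_norm)
        also have "\<dots> \<le> L * dist x y" by (rule lipschitz_onD[OF f]) auto
        finally show "dist (norm (f x - p)) (norm (f y - p)) \<le> L * dist x y" .
      qed (rule lipschitz_on_nonneg[OF f])
      show "negligible ((\<lambda>t. norm (f t - p)) ` K N)" if "p \<in> P" for p
      proof (rule negligible_subset)
        show "negligible (pinned_distances p E)"
          using P(2) that by (intro hausdorff1_null_imp_negligible) (auto simp: bad_pins_def)
        show "(\<lambda>t. norm (f t - p)) ` K N \<subseteq> pinned_distances p E"
          by (auto simp: pinned_distances_def K_def)
      qed
      show "K N \<subseteq> {- real N..real N}" by (simp add: K_def)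
    qed (use C(2) in auto)
  qed
  let ?I = "(UNIV :: nat set) \<times> (UNIV :: nat set) \<times> {-1, 0, 1 :: real}"
  have "hausdorff1 (\<Union>(N, m, s)\<in>?I. f ` K N \<inter> T m s) = 0"
    by (rule hausdorff1_null_UN) (auto intro!: piece)
  moreover have "E \<inter> range f \<subseteq> (\<Union>(N, m, s)\<in>?I. f ` K N \<inter> T m s)"
  proof clarify
    fix t assume "f t \<in> E"
    obtain N :: nat where N: "\<bar>t\<bar> \<le> real N" using real_arch_simple by blast
    have tK: "t \<in> K N" using N \<open>f t \<in> E\<close> by (auto simp: K_def)
    obtain m :: nat where m: "max (norm (f t)) (1 / \<bar>h (f t)\<bar>) \<le> real m"
      using real_arch_simple by blast
    have "f t \<in> T m (sgn (h (f t)))"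
    proof (cases "h (f t) = 0")
      case False
      then have "1 \<le> real m * \<bar>h (f t)\<bar>"
        using m by (simp add: field_simps)
      then have "1 \<le> \<bar>h (f t)\<bar> + real m * \<bar>h (f t)\<bar>"
        by (rule order_trans) simp
      then have "1 / Suc m \<le> \<bar>h (f t)\<bar>"
        using False by (simp add: field_simps)
      then show ?thesis using m by (simp add: T_def sgn_0_0 abs_sgn mult.commute)
    qed (use m in \<open>simp add: T_def\<close>)
    moreover have "sgn (h (f t)) \<in> {-1, 0, 1}" by (auto simp: sgn_if)
    ultimately show "f t \<in> (\<Union>(N, m, s)\<in>?I. f ` K N \<inter> T m s)"
      using tK by (intro UN_I[of "(N, m, sgn (h (f t)))"]) auto
  qed
  ultimately show ?thesis by (rule hausdorff1_null_subset)
qed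

theorem theorem2p6:
  fixes E :: "(real ^ 'n) set"
  assumes "CARD('n) \<ge> 2"
    and "rectifiable1 E"
    and "hausdorff1 E > 0"
  shows "\<exists>A :: (real ^ 'n) set.
    affine A \<and> A \<noteq> {} \<and> aff_dim A \<le> int CARD('n) - 2 \<and> bad_pins E \<subseteq> A"
proof (cases "aff_dim (bad_pins E) \<le> int CARD('n) - 2")
  case True
  show ?thesis
  proof (cases "bad_pins E = {}")
    case True
    then show ?thesis using assms(1) by (intro exI[of _ "{0}"]) auto
  next
    case False
    then show ?thesis using True
      by (intro exI[of _ "affine hull (bad_pins E)"]) (auto simp: hull_subset)
  qed
next
  case False
  obtain P where P: "P \<subseteq> bad_pins E" "\<not> affine_dependent P" "affine hull bad_pins E = affine hull P"
    using affine_basis_exists by blast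
  have fin: "finite P" using P(2) by (rule aff_independent_finite)
  have ad: "aff_dim P > int CARD('n) - 2"
    using False P(3) by (metis aff_dim_affine_hull not_le)
  then have "P \<noteq> {}" using assms(1) by auto
  then obtain p0 where p0: "p0 \<in> P" by blast
  have "aff_dim P = int (dim ((\<lambda>p. p - p0) ` P))"
    using p0 by (intro aff_dim_eq_dim_subtract) (simp add: hull_inc)
  with ad have dim: "DIM(real ^ 'n) \<le> Suc (dim ((\<lambda>p. p - p0) ` P))"
    by simp
  obtain f :: "nat \<Rightarrow> real \<Rightarrow> real ^ 'n" where E: "E \<in> sets borel"
    and f: "\<And>j. \<exists>L. L-lipschitz_on UNIV (f j)"
    and rest: "hausdorff1 (E - (\<Union>j. range (f j))) = 0"
    using assms(2) unfolding rectifiable1_def by blast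
  have curve: "hausdorff1 (E \<inter> range (f j)) = 0" for j
    using f[of j] hausdorff1_null_curve_if_bad_pins[OF E _ fin P(1) p0 dim] by blast
  let ?A = "\<lambda>i. case i of None \<Rightarrow> E - (\<Union>j. range (f j)) | Some j \<Rightarrow> E \<inter> range (f j)"
  have "hausdorff1 (\<Union>i\<in>UNIV. ?A i) = 0"
    by (rule hausdorff1_null_UN) (auto simp: rest curve split: option.split)
  moreover have "E \<subseteq> (\<Union>i\<in>UNIV. ?A i)"
    by (auto simp: UNIV_option_conv)
  ultimately have "hausdorff1 E = 0" by (rule hausdorff1_null_subset)
  then show ?thesis using assms(3) by simp
qed

end
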